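(* Let $F$ be one of $\mathbb{R},\mathbb{C},\mathbb{H}$ and let $\{n_N\}_{N=1}^\infty$ be a sequence of positive integers with $n_N\le N$ for all $N$. Then the Prohorov distance between the Haar probability measure on the $(N,n_N)$-Stiefel manifold over $F$ with distance multiplied by $\sqrt{N^F-1}$ and the Gaussian measure $\gamma^{N^Fn_N}$ on $M^F_{N,n_N}$ is bounded away from zero for all $N=1,2,\dots$; that is, there is a constant $c_0>0$ with $d_{\mathrm{P}}(\mu^{N,n_N,F},\gamma^{N^Fn_N})\ge c_0$ for all $N$.
   Context: $\mathbb{H}$ denotes the quaternions; $N^F:=N\cdot\dim_{\mathbb{R}}F$. $M^F_{N,n}$ is the set of $N\times n$ matrices over $F$ with Frobenius norm $\|Z\|=\sqrt{\operatorname{tr}(Z^*Z)}$ and distance $\|Z-W\|$; it is identified with $\mathbb{R}^{N^Fn}$, and $\gamma^{N^Fn}$ is the standard Gaussian measure on it. For $n\le N$, the Stiefel manifold is $V^F_{N,n}=\{Z\in M^F_{N,n}:Z^*Z=I_n\}$ with its Haar probability measure (the unique Borel probability measure invariant under left multiplication by the unitary group $U^F(N)$). The Stiefel manifold with distance multiplied by $\sqrt{N^F-1}$ is identified with $X^F_{N,n}:=\sqrt{N^F-1}\,V^F_{N,n}\subset M^F_{N,n}$, and $\mu^{N,n,F}$ denotes its Haar probability measure (push-forward of the Haar measure of $V^F_{N,n}$ under $Z\mapsto\sqrt{N^F-1}\,Z$), regarded as a Borel probability measure on $M^F_{N,n}$. The Prohorov distance $d_{\mathrm{P}}(\mu,\nu)$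 between Borel probability measures on a metric space $X$ is the infimum of $\varepsilon>0$ with $\mu(B_\varepsilon(A))\ge\nu(A)-\varepsilon$ for every Borel set $A\subset X$, where $B_\varepsilon(A)=\{x\in X: d_X(x,A)<\varepsilon\}$. *)

theory Defs
  imports "HOL-Probability.Probability" "Jordan_Normal_Form.Conjugate" "Jordan_Normal_Form.Matrix"
begin

section \<open>Quaternions\<close>

datatype quat = Quat (qre: real) (qi: real) (qj: real) (qk: real)

lemma quat_eq_iff: "x = y \<longleftrightarrow> qre x = qre y \<and> qi x = qi y \<and> qj x = qj y \<and> qk x = qk y"
  by (cases x; cases y) simp

instantiation quat :: ring_1
begin

definition "0 = Quat 0 0 0 0"
definition "1 = Quat 1 0 0 0"
definition "x + y = Quat (qre x + qre y) (qi x + qi y) (qj x + qj y) (qk x + qk y)"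
definition "x - y = Quat (qre x - qre y) (qi x - qi y) (qj x - qj y) (qk x - qk y)"
definition "- x = Quat (- qre x) (- qi x) (- qj x) (- qk x)"
definition "x * y = Quat
  (qre x * qre y - qi x * qi y - qj x * qj y - qk x * qk y)
  (qre x * qi y + qi x * qre y + qj x * qk y - qk x * qj y)
  (qre x * qj y - qi x * qk y + qj x * qre y + qk x * qi y)
  (qre x * qk y + qi x * qj y - qj x * qi y + qk x * qre y)"

instance
  by standard
    (simp_all add: zero_quat_def one_quat_def plus_quat_def minus_quat_def uminus_quat_def
      times_quat_def quat_eq_iff algebra_simps)

end

lemma quat_sel_simps [simp]:
  "qre 0 = 0" "qi 0 = 0" "qj 0 = 0" "qk 0 = 0"
  "qre 1 = 1" "qi 1 = 0" "qj 1 = 0" "qk 1 = 0"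
  "qre (x + y) = qre x + qre y" "qi (x + y) = qi x + qi y"
  "qj (x + y) = qj x + qj y" "qk (x + y) = qk x + qk y"
  "qre (x - y) = qre x - qre y" "qi (x - y) = qi x - qi y"
  "qj (x - y) = qj x - qj y" "qk (x - y) = qk x - qk y"
  "qre (- x) = - qre x" "qi (- x) = - qi x" "qj (- x) = - qj x" "qk (- x) = - qk x"
  by (simp_all add: zero_quat_def one_quat_def plus_quat_def minus_quat_def uminus_quat_def)

lemma quat_mult_sel:
  "qre (x * y) = qre x * qre y - qi x * qi y - qj x * qj y - qk x * qk y"
  "qi (x * y) = qre x * qi y + qi x * qre y + qj x * qk y - qk x * qj y"
  "qj (x * y) = qre x * qj y - qi x * qk y + qj x * qre y + qk x * qi y"
  "qk (x * y) = qre x * qk y + qi x * qj y - qj x * qi y + qk x * qre y"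
  by (simp_all add: times_quat_def)

instantiation quat :: conjugate
begin

definition "conjugate x = Quat (qre x) (- qi x) (- qj x) (- qk x)"

instance
  by standard (auto simp: conjugate_quat_def quat_eq_iff)

end

lemma quat_conjugate_sel [simp]:
  "qre (conjugate x) = qre x" "qi (conjugate x) = - qi x"
  "qj (conjugate x) = - qj x" "qk (conjugate x) = - qk x"
  by (simp_all add: conjugate_quat_def)

instantiation quat :: real_algebra_1
begin

definition "r *\<^sub>R x = Quat (r * qre x) (r * qi x) (r * qj x) (r * qk x)"

instance
  by standard (simp_all add: scaleR_quat_def quat_eq_iff quat_mult_sel algebra_simps)

end

lemma quat_scaleR_sel [simp]:
  "qre (r *\<^sub>R x) = r * qre x" "qi (r *\<^sub>R x) = r * qi x"
  "qj (r *\<^sub>R x) = r * qj x" "qk (r *\<^sub>R x) = r * qk x"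
  by (simp_all add: scaleR_quat_def)

instantiation quat :: real_div_algebra
begin

definition "inverse x =
  conjugate x /\<^sub>R ((qre x)\<^sup>2 + (qi x)\<^sup>2 + (qj x)\<^sup>2 + (qk x)\<^sup>2)" for x :: quat
definition "x div y = x * inverse y" for x y :: quat

lemma quat_sqsum_pos:
  "x \<noteq> 0 \<Longrightarrow> (qre x)\<^sup>2 + (qi x)\<^sup>2 + (qj x)\<^sup>2 + (qk x)\<^sup>2 > 0"
  by (auto simp: quat_eq_iff add_pos_nonneg add_nonneg_pos)

instance
proof
  fix x y :: quat
  show "x div y = x * inverse y" by (simp add: divide_quat_def)
  show "inverse (0::quat) = 0" by (simp add: inverse_quat_def quat_eq_iff)
  assume "x \<noteq> 0"
  then have "(qre x)\<^sup>2 + (qi x)\<^sup>2 + (qj x)\<^sup>2 + (qk x)\<^sup>2 \<noteq> 0"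
    using quat_sqsum_pos[of x] by simp
  moreover have "conjugate x * x = ((qre x)\<^sup>2 + (qi x)\<^sup>2 + (qj x)\<^sup>2 + (qk x)\<^sup>2) *\<^sub>R 1"
    and "x * conjugate x = ((qre x)\<^sup>2 + (qi x)\<^sup>2 + (qj x)\<^sup>2 + (qk x)\<^sup>2) *\<^sub>R 1"
    by (simp_all add: quat_eq_iff quat_mult_sel power2_eq_square)
  ultimately show "inverse x * x = 1" "x * inverse x = 1"
    by (simp_all add: inverse_quat_def)
qed

end

instantiation quat :: real_inner
begin

definition "inner x y = qre x * qre y + qi x * qi y + qj x * qj y + qk x * qk y"
definition "norm x = sqrt ((qre x)\<^sup>2 + (qi x)\<^sup>2 + (qj x)\<^sup>2 + (qk x)\<^sup>2)"
definition "sgn x = x /\<^sub>R norm x" for x :: quat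
definition "dist x y = norm (x - y)" for x y :: quat
definition
  "uniformity = (INF e\<in>{0<..}. principal {(x::quat, y). dist x y < e})"
definition
  "open (U::quat set) \<longleftrightarrow> (\<forall>x\<in>U. eventually (\<lambda>(x', y). x' = x \<longrightarrow> y \<in> U) uniformity)"

instance
proof
  fix x y z :: quat and r :: real
  show "dist x y = norm (x - y)" by (rule dist_quat_def)
  show "sgn x = x /\<^sub>R norm x" by (rule sgn_quat_def)
  show "uniformity = (INF e\<in>{0<..}. principal {(x::quat, y). dist x y < e})"
    by (rule uniformity_quat_def)
  show "open U \<longleftrightarrow> (\<forall>x\<in>U. eventually (\<lambda>(x', y). x' = x \<longrightarrow> y \<in> U) uniformity)"
    for U :: "quat set"
    by (rule open_quat_def)
  show "inner x y = inner y x" "inner (x + y) z = inner x z + inner y z"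
    "inner (r *\<^sub>R x) y = r * inner x y"
    by (simp_all add: inner_quat_def algebra_simps)
  show "0 \<le> inner x x" by (simp add: inner_quat_def)
  show "inner x x = 0 \<longleftrightarrow> x = 0"
  proof
    assume "inner x x = 0"
    then show "x = 0"
      using quat_sqsum_pos[of x] by (cases "x = 0") (simp_all add: inner_quat_def power2_eq_square)
  qed (simp add: inner_quat_def)
  show "norm x = sqrt (inner x x)"
    by (simp add: norm_quat_def inner_quat_def power2_eq_square)
qed

end

instance quat :: real_normed_div_algebra
proof
  fix x y :: quat
  show "norm (x * y) = norm x * norm y"
    unfolding norm_quat_def real_sqrt_mult[symmetric]
    by (rule arg_cong[where f = sqrt])
      (simp add: quat_mult_sel power2_eq_square algebra_simps)
qed

instantiation quat :: euclidean_space
begin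

definition "Basis = {Quat 1 0 0 0, Quat 0 1 0 0, Quat 0 0 1 0, Quat 0 0 0 1}"

instance
proof
  show "(Basis :: quat set) \<noteq> {}" "finite (Basis :: quat set)"
    by (simp_all add: Basis_quat_def)
next
  fix u v :: quat
  assume "u \<in> Basis" "v \<in> Basis"
  then show "inner u v = (if u = v then 1 else 0)"
    unfolding Basis_quat_def by (elim insertE emptyE) (simp_all add: inner_quat_def)
next
  fix x :: quat
  show "(\<forall>u\<in>Basis. inner x u = 0) \<longleftrightarrow> x = 0"
    by (simp add: Basis_quat_def inner_quat_def) (simp add: quat_eq_iff)
qed

end

lemma DIM_quat [simp]: "DIM(quat) = 4"
  by (simp add: Basis_quat_def)


section \<open>The scalars\<close>

text \<open>
  The class only serves to share the definitions below between the real numbers, the complex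
  numbers and the quaternions.
\<close>

class conj_division_algebra = real_normed_div_algebra + euclidean_space + conjugate +
  assumes conjugate_mult_self: "conjugate z * z = ((norm z)\<^sup>2) *\<^sub>R 1"

instance real :: conj_division_algebra
  by standard (simp add: power2_eq_square)

instance complex :: conj_division_algebra
proof
  fix z :: complex
  have "conjugate z * z = z * cnj z" by simp
  also have "\<dots> = of_real ((norm z)\<^sup>2)" by (rule complex_norm_square[symmetric])
  also have "\<dots> = ((norm z)\<^sup>2) *\<^sub>R 1" by (rule of_real_def)
  finally show "conjugate z * z = ((norm z)\<^sup>2) *\<^sub>R 1" .
qed

instance quat :: conj_division_algebra
  by standard (simp add: quat_eq_iff quat_mult_sel norm_quat_def power2_eq_square)


section \<open>Matrices with the Frobenius distance\<close>

definition conj_transpose :: "'a::conjugate mat \<Rightarrow> 'a mat" where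
  "conj_transpose A = map_mat conjugate (transpose_mat A)"

definition mat_trace :: "'a::comm_monoid_add mat \<Rightarrow> 'a" where
  "mat_trace A = (\<Sum>i<dim_row A. A $$ (i, i))"

text \<open>\<open>inner 1\<close> is the real part; the trace of \<open>Z\<^sup>* Z\<close> is a real scalar
  (cf. \<open>mat_trace_conj_transpose_mult\<close>).\<close>

definition frobenius_norm :: "'a::conj_division_algebra mat \<Rightarrow> real" where
  "frobenius_norm Z = sqrt (inner 1 (mat_trace (conj_transpose Z * Z)))"

text \<open>The library's metric spaces need a distance that is nonnegative and symmetric on the whole
  type; the value for matrices of different dimensions is irrelevant.\<close>

definition frobenius_dist :: "'a::conj_division_algebra mat \<Rightarrow> 'a mat \<Rightarrow> real" where
  "frobenius_dist Z W =
     (if dim_row Z = dim_row W \<and> dim_col Z = dim_col W then frobenius_norm (Z - W) else 0)"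

definition mat_metric :: "nat \<Rightarrow> nat \<Rightarrow> 'a::conj_division_algebra mat metric" where
  "mat_metric N n = metric (carrier_mat N n, frobenius_dist)"

lemma mat_trace_conj_transpose_mult:
  "mat_trace (conj_transpose Z * Z) =
     of_real (\<Sum>j<dim_col Z. \<Sum>i<dim_row Z. (norm (Z $$ (i, j)))\<^sup>2)"
  for Z :: "'a::conj_division_algebra mat"
proof -
  have "(conj_transpose Z * Z) $$ (j, j) = of_real (\<Sum>i<dim_row Z. (norm (Z $$ (i, j)))\<^sup>2)"
    if "j < dim_col Z" for j
    using that
    by (simp add: conj_transpose_def scalar_prod_def conjugate_mult_self of_real_def atLeast0LessThan
      scaleR_sum_left)
  then show ?thesis
    by (simp add: mat_trace_def conj_transpose_def)
qed

lemma frobenius_norm_altdef: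
  "frobenius_norm Z = L2_set (\<lambda>ij. norm (Z $$ ij)) ({..<dim_row Z} \<times> {..<dim_col Z})"
proof -
  have "inner 1 (of_real r :: 'a) = r" for r
    by (simp add: of_real_def dot_square_norm)
  moreover have "(\<Sum>j<dim_col Z. \<Sum>i<dim_row Z. (norm (Z $$ (i, j)))\<^sup>2) =
      (\<Sum>ij\<in>{..<dim_row Z} \<times> {..<dim_col Z}. (norm (Z $$ ij))\<^sup>2)"
    by (subst sum.swap) (simp add: sum.cartesian_product)
  ultimately show ?thesis
    unfolding frobenius_norm_def mat_trace_conj_transpose_mult L2_set_def by (simp only:)
qed

lemma Metric_space_mat:
  "Metric_space (carrier_mat N n :: 'a::conj_division_algebra mat set) frobenius_dist"
proof
  fix X Y Z :: "'a mat"
  show "0 \<le> frobenius_dist X Y"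
    by (simp add: frobenius_dist_def frobenius_norm_altdef L2_set_nonneg)
  show "frobenius_dist X Y = frobenius_dist Y X"
    by (auto simp: frobenius_dist_def frobenius_norm_altdef norm_minus_commute intro!: L2_set_cong)
  have *: "frobenius_dist X Y = L2_set (\<lambda>ij. norm (X $$ ij - Y $$ ij)) ({..<N} \<times> {..<n})"
    if "X \<in> carrier_mat N n" "Y \<in> carrier_mat N n" for X Y :: "'a mat"
    using that by (auto simp: frobenius_dist_def frobenius_norm_altdef intro!: L2_set_cong)
  assume X: "X \<in> carrier_mat N n" and Y: "Y \<in> carrier_mat N n"
  show "frobenius_dist X Y = 0 \<longleftrightarrow> X = Y"
    using X Y by (auto simp: *[OF X Y] L2_set_eq_0_iff)
  assume Z: "Z \<in> carrier_mat N n"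
  have "frobenius_dist X Z \<le> L2_set (\<lambda>ij. norm (X $$ ij - Y $$ ij) + norm (Y $$ ij - Z $$ ij))
      ({..<N} \<times> {..<n})"
    unfolding *[OF X Z]
  proof (rule L2_set_mono)
    show "norm (X $$ ij - Z $$ ij) \<le> norm (X $$ ij - Y $$ ij) + norm (Y $$ ij - Z $$ ij)" for ij
      using norm_triangle_ineq[of "X $$ ij - Y $$ ij" "Y $$ ij - Z $$ ij"] by simp
  qed simp
  also have "\<dots> \<le> frobenius_dist X Y + frobenius_dist Y Z"
    unfolding *[OF X Y] *[OF Y Z] by (rule L2_set_triangle_ineq)
  finally show "frobenius_dist X Z \<le> frobenius_dist X Y + frobenius_dist Y Z" .
qed

lemma mspace_mat_metric [simp]: "mspace (mat_metric N n) = carrier_mat N n"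
  by (simp add: mat_metric_def Metric_space.mspace_metric Metric_space_mat)

lemma mdist_mat_metric [simp]: "mdist (mat_metric N n) = frobenius_dist"
  by (simp add: mat_metric_def Metric_space.mdist_metric Metric_space_mat)


section \<open>Prohorov distance\<close>

definition mborel :: "'a metric \<Rightarrow> 'a measure" where
  "mborel m = sigma (mspace m) {U. openin (mtopology_of m) U}"

text \<open>The distance to \<open>A\<close> is taken in \<^typ>\<open>ereal\<close>, so that the distance to the empty set
  is infinite.\<close>

definition mthicken :: "'a metric \<Rightarrow> real \<Rightarrow> 'a set \<Rightarrow> 'a set" where
  "mthicken m \<epsilon> A = {x \<in> mspace m. (INF a\<in>A. ereal (mdist m x a)) < ereal \<epsilon>}"

definition prohorov_dist :: "'a metric \<Rightarrow> 'a measure \<Rightarrow> 'a measure \<Rightarrow> real" where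
  "prohorov_dist m \<mu> \<nu> =
     Inf {\<epsilon>. 0 < \<epsilon> \<and> (\<forall>A\<in>sets (mborel m). measure \<mu> (mthicken m \<epsilon> A) \<ge> measure \<nu> A - \<epsilon>)}"


section \<open>Gaussian measure and Haar measure\<close>

definition std_gauss :: "'a::euclidean_space measure" where
  "std_gauss = density lborel (\<lambda>z. ennreal (\<Prod>b\<in>Basis. std_normal_density (inner z b)))"

definition mat_gauss :: "nat \<Rightarrow> nat \<Rightarrow> 'a::conj_division_algebra mat measure" where
  "mat_gauss N n =
     distr (PiM ({..<N} \<times> {..<n}) (\<lambda>_. std_gauss)) (mborel (mat_metric N n)) (mat N n)"

definition unitary_mats :: "nat \<Rightarrow> 'a::conj_division_algebra mat set" where
  "unitary_mats N =
     {U \<in> carrier_mat N N. conj_transpose U * U = 1\<^sub>m N \<and> U * conj_transpose U = 1\<^sub>m N}"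

definition stiefel :: "nat \<Rightarrow> nat \<Rightarrow> 'a::conj_division_algebra mat set" where
  "stiefel N n = {Z \<in> carrier_mat N n. conj_transpose Z * Z = 1\<^sub>m n}"

text \<open>For \<open>n \<le> N\<close> there is exactly one such measure.\<close>

definition is_stiefel_haar :: "nat \<Rightarrow> nat \<Rightarrow> 'a::conj_division_algebra mat measure \<Rightarrow> bool" where
  "is_stiefel_haar N n \<sigma> \<longleftrightarrow>
     prob_space \<sigma> \<and>
     sets \<sigma> = sets (mborel (submetric (mat_metric N n) (stiefel N n))) \<and>
     (\<forall>U\<in>unitary_mats N. distr \<sigma> \<sigma> (\<lambda>Z. U * Z) = \<sigma>)"

text \<open>The push-forward of \<open>\<sigma>\<close> under \<open>Z \<mapsto> sqrt (N\<^sup>F - 1) Z\<close>, where \<open>N\<^sup>F = N * DIM('a)\<close>.\<close>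

definition rescale_stiefel ::
    "nat \<Rightarrow> nat \<Rightarrow> 'a::conj_division_algebra mat measure \<Rightarrow> 'a mat measure" where
  "rescale_stiefel N n \<sigma> =
     distr \<sigma> (mborel (mat_metric N n))
       (\<lambda>Z. of_real (sqrt (real (N * DIM('a)) - 1)) \<cdot>\<^sub>m Z)"

end

theory Submission
  imports Defs
begin

text \<open>
  Write \<open>d = N * n * DIM('a)\<close> for the real dimension of the space of matrices over \<open>'a\<close>. Every point of the
  rescaled Stiefel manifold has Frobenius norm \<open>sqrt (N * DIM('a) - 1) * sqrt n\<close>, which is at most
  \<open>sqrt d\<close>. A Gaussian matrix, on the other hand, has norm close to \<open>sqrt d\<close>, but with fluctuations
  whose size does not shrink as \<open>d\<close> grows: its squared norm has mean \<open>d\<close> and standard deviation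
  \<open>sqrt (2 * d)\<close>. So for suitable \<open>\<epsilon>, c > 0\<close> that depend only on the scalars, the Gaussian measure
  gives mass at least \<open>c\<close> to the set of matrices of norm above \<open>sqrt d + \<epsilon>\<close>, and this set has
  distance at least \<open>\<epsilon>\<close> from the manifold. Testing the definition of the Prohorov distance on this
  set (\<open>prohorov_dist_ge\<close>) gives the lower bound \<open>min c \<epsilon>\<close>.

  The uniform bound \<open>c\<close> could be had from the central limit theorem when \<open>d\<close> is large, but a fourth
  moment argument covers all \<open>d\<close> at once. The squared norm minus \<open>d\<close> is a sum of \<open>m = N * n\<close>
  independent copies of the centred variable \<open>(norm z)\<^sup>2 - DIM('a)\<close>. Such a sum has mean \<open>0\<close>, second
  moment proportional to \<open>m\<close> and fourth moment \<open>O(m\<^sup>2)\<close> (\<open>moments_PiM_sum\<close>); after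
  normalisation these moments are bounded uniformly in \<open>m\<close>, and that alone forces the sum to exceed
  a fixed multiple of \<open>sqrt m\<close> with a probability bounded below
  (\<open>upper_deviation_from_fourth_moment\<close>).
\<close>

section \<open>Anticoncentration of sums of independent variables\<close>

lemma (in finite_measure) integrable_lower_power:
  fixes f :: "'a \<Rightarrow> real"
  assumes "f \<in> borel_measurable M" "integrable M (\<lambda>x. f x ^ m)" "even m" "k \<le> m"
  shows "integrable M (\<lambda>x. f x ^ k)"
proof (rule Bochner_Integration.integrable_bound)
  show "integrable M (\<lambda>x. 1 + f x ^ m)" using assms by simp
  show "(\<lambda>x. f x ^ k) \<in> borel_measurable M" using assms by simp
  have "\<bar>y\<bar> ^ k \<le> 1 + \<bar>y\<bar> ^ m" for y :: real
  proof (cases "\<bar>y\<bar> \<le> 1")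
    case True
    then have "\<bar>y\<bar> ^ k \<le> 1" by (simp add: power_le_one)
    then show ?thesis by (simp add: add_increasing2)
  next
    case False
    then have "\<bar>y\<bar> ^ k \<le> \<bar>y\<bar> ^ m" using \<open>k \<le> m\<close> by (intro power_increasing) auto
    then show ?thesis by simp
  qed
  then show "AE x in M. norm (f x ^ k) \<le> norm (1 + f x ^ m)"
    using \<open>even m\<close> by (auto simp: power_abs power_even_abs)
qed

text \<open>
  Induction on the index set: expanding \<open>(x + S)\<^sup>4\<close> for a new summand \<open>x\<close>, independence factors
  each mixed moment, and centring kills those that contain \<open>x\<close> or \<open>S\<close> to the first power. What is left is \<open>E x\<^sup>4 + 6 * E x\<^sup>2 * E S\<^sup>2 + E S\<^sup>4\<close>.
\<close>

lemma (in prob_space) moments_indep_sum: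
  fixes X :: "'i \<Rightarrow> 'a \<Rightarrow> real"
  assumes "finite I" and "indep_vars (\<lambda>_. borel) X I"
    and "\<And>i. i \<in> I \<Longrightarrow> integrable M (\<lambda>\<omega>. X i \<omega> ^ 4)"
    and "\<And>i. i \<in> I \<Longrightarrow> expectation (X i) = 0"
    and "\<And>i. i \<in> I \<Longrightarrow> expectation (\<lambda>\<omega>. X i \<omega> ^ 2) = v"
    and "\<And>i. i \<in> I \<Longrightarrow> expectation (\<lambda>\<omega>. X i \<omega> ^ 4) = K"
  defines "m \<equiv> real (card I)" and "S \<equiv> \<lambda>\<omega>. \<Sum>i\<in>I. X i \<omega>"
  shows "integrable M (\<lambda>\<omega>. S \<omega> ^ 4)" and "expectation S = 0"
    and "expectation (\<lambda>\<omega>. S \<omega> ^ 2) = m * v"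
    and "expectation (\<lambda>\<omega>. S \<omega> ^ 4) = m * K + 3 * m * (m - 1) * v ^ 2"
proof -
  have "integrable M (\<lambda>\<omega>. (\<Sum>i\<in>I. X i \<omega>) ^ 4) \<and> expectation (\<lambda>\<omega>. \<Sum>i\<in>I. X i \<omega>) = 0 \<and>
    expectation (\<lambda>\<omega>. (\<Sum>i\<in>I. X i \<omega>) ^ 2) = real (card I) * v \<and>
    expectation (\<lambda>\<omega>. (\<Sum>i\<in>I. X i \<omega>) ^ 4) =
      real (card I) * K + 3 * real (card I) * (real (card I) - 1) * v ^ 2"
    using assms(1-6)
  proof (induction I rule: finite_induct)
    case empty
    then show ?case by simp
  next
    case (insert i I)
    let ?x = "X i" and ?S = "\<lambda>\<omega>. \<Sum>i\<in>I. X i \<omega>"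
    have indI: "indep_vars (\<lambda>_. borel) X I"
      using insert.prems(1) by (rule indep_vars_subset) auto
    have IH: "integrable M (\<lambda>\<omega>. ?S \<omega> ^ 4)" "expectation ?S = 0"
        "expectation (\<lambda>\<omega>. ?S \<omega> ^ 2) = real (card I) * v"
        "expectation (\<lambda>\<omega>. ?S \<omega> ^ 4) =
           real (card I) * K + 3 * real (card I) * (real (card I) - 1) * v ^ 2"
      using insert.IH[OF indI insert.prems(2-5)] by blast+
    have [measurable]: "X j \<in> borel_measurable M" if "j \<in> insert i I" for j
      using insert.prems(1) that unfolding indep_vars_def by blast
    have [measurable]: "?x \<in> borel_measurable M" "?S \<in> borel_measurable M"
      by (auto intro!: borel_measurable_sum)
    have int_x: "integrable M (\<lambda>\<omega>. ?x \<omega> ^ a)" and int_S: "integrable M (\<lambda>\<omega>. ?S \<omega> ^ a)" if "a \<le> 4" for a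
      using that insert.prems(2)[of i] IH(1)
      by (auto intro!: integrable_lower_power[where m = 4])
    have ind: "indep_var borel (\<lambda>\<omega>. ?x \<omega> ^ a) borel (\<lambda>\<omega>. ?S \<omega> ^ b)" for a b
      using indep_var_compose[OF indep_vars_sum[OF insert.hyps insert.prems(1)],
          of "\<lambda>y. y ^ a" borel "\<lambda>y. y ^ b" borel] by (simp add: comp_def)
    have int: "integrable M (\<lambda>\<omega>. ?x \<omega> ^ a * ?S \<omega> ^ b)"
      and ex: "expectation (\<lambda>\<omega>. ?x \<omega> ^ a * ?S \<omega> ^ b) =
        expectation (\<lambda>\<omega>. ?x \<omega> ^ a) * expectation (\<lambda>\<omega>. ?S \<omega> ^ b)"
      if "a \<le> 4" "b \<le> 4" for a b
      using indep_var_integrable[OF ind int_x int_S] indep_var_lebesgue_integral[OF ind int_x int_S] that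
      by auto
    have sum: "(\<Sum>j\<in>insert i I. X j \<omega>) = ?x \<omega> + ?S \<omega>" for \<omega>
      using insert.hyps by simp
    have pow4: "(\<Sum>j\<in>insert i I. X j \<omega>) ^ 4 =
        ?x \<omega> ^ 4 + 4 * (?x \<omega> ^ 3 * ?S \<omega> ^ 1) + 6 * (?x \<omega> ^ 2 * ?S \<omega> ^ 2) + 4 * (?x \<omega> ^ 1 * ?S \<omega> ^ 3) + ?S \<omega> ^ 4" for \<omega>
      unfolding sum by (simp add: power4_eq_xxxx power2_eq_square power3_eq_cube algebra_simps)
    have pow2: "(\<Sum>j\<in>insert i I. X j \<omega>) ^ 2 = ?x \<omega> ^ 2 + 2 * (?x \<omega> ^ 1 * ?S \<omega> ^ 1) + ?S \<omega> ^ 2" for \<omega>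
      unfolding sum by (simp add: power2_eq_square algebra_simps)
    have c: "real (card (insert i I)) = real (card I) + 1"
      using insert.hyps by simp
    have x: "expectation ?x = 0" "expectation (\<lambda>\<omega>. ?x \<omega> ^ 2) = v" "expectation (\<lambda>\<omega>. ?x \<omega> ^ 4) = K"
      using insert.prems by auto
    have "integrable M (\<lambda>\<omega>. (\<Sum>j\<in>insert i I. X j \<omega>) ^ 4)"
      unfolding pow4 by (intro Bochner_Integration.integrable_add integrable_mult_right int int_x int_S) auto
    moreover have "expectation (\<lambda>\<omega>. \<Sum>j\<in>insert i I. X j \<omega>) = 0"
      unfolding sum using int_x[of 1] int_S[of 1] x IH by (simp add: Bochner_Integration.integral_add)
    moreover have "expectation (\<lambda>\<omega>. (\<Sum>j\<in>insert i I. X j \<omega>) ^ 2) = real (card (insert i I)) * v"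
      unfolding pow2 c using int[of 1 1] int_x[of 2] int_S[of 2] ex[of 1 1] x IH
      by (simp add: algebra_simps)
    moreover have "expectation (\<lambda>\<omega>. (\<Sum>j\<in>insert i I. X j \<omega>) ^ 4) =
        real (card (insert i I)) * K + 3 * real (card (insert i I)) * (real (card (insert i I)) - 1) * v ^ 2"
    proof -
      have "expectation (\<lambda>\<omega>. (\<Sum>j\<in>insert i I. X j \<omega>) ^ 4) = K + 6 * (v * (real (card I) * v))
          + (real (card I) * K + 3 * real (card I) * (real (card I) - 1) * v ^ 2)"
        unfolding pow4
        using int[of 3 1] int[of 2 2] int[of 1 3] int_x[of 4] int_S[of 4] ex[of 3 1] ex[of 2 2] ex[of 1 3] x IH
        by simp
      then show ?thesis unfolding c by (simp add: power2_eq_square algebra_simps)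
    qed
    ultimately show ?case by blast
  qed
  then show "integrable M (\<lambda>\<omega>. S \<omega> ^ 4)" "expectation S = 0"
    "expectation (\<lambda>\<omega>. S \<omega> ^ 2) = m * v"
    "expectation (\<lambda>\<omega>. S \<omega> ^ 4) = m * K + 3 * m * (m - 1) * v ^ 2"
    unfolding m_def S_def by auto
qed

text \<open>
  A multiple of the indicator of an upper tail dominates a quartic polynomial whose expectation is
  positive under bounds on the first four moments. The linear and quartic terms together outweigh
  \<open>s\<^sup>2\<close> for negative \<open>s\<close>, the quartic term bounds the polynomial from above for positive \<open>s\<close>, and the subtracted constant makes it
  nonpositive on a small interval to the right of \<open>0\<close>.
\<close>

lemma quartic_minorant:
  fixes s K :: real
  assumes K: "K \<ge> 1"
  shows "2 * K * s + s ^ 2 - s ^ 4 / (2 * K) - 1 / 4 \<le> (K ^ 2 + 2 * K) * (if s > 1 / (16 * K) then 1 else 0)"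
proof -
  have pos: "0 \<le> s ^ 4 / (2 * K)" using K by simp
  consider "s > 1 / (16 * K)" | "0 \<le> s" "s \<le> 1 / (16 * K)" | "s < 0" by linarith
  then show ?thesis
  proof cases
    case 1
    \<comment> \<open>Completing the square in \<open>s ^ 2\<close> bounds the polynomial for large \<open>s\<close>.\<close>
    have "0 \<le> (s ^ 2 - 2 * K) ^ 2 / (2 * K)" using K by simp
    also have "\<dots> = s ^ 4 / (2 * K) - 2 * s ^ 2 + 2 * K"
      using K by (simp add: field_simps power2_eq_square power4_eq_xxxx)
    finally have "2 * s ^ 2 - s ^ 4 / (2 * K) \<le> 2 * K" by simp
    moreover have "2 * K * s \<le> K ^ 2 + s ^ 2"
      using sum_squares_bound[of K s] by simp
    ultimately show ?thesis using 1 by simp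
  next
    case 2
    have "16 * (K * s) \<le> 1" using 2 K by (simp add: field_simps)
    moreover have "s \<le> 1 / 16" using 2 K by (smt (verit) frac_le)
    then have "s ^ 2 \<le> (1 / 16) ^ 2" using 2 by (intro power_mono) auto
    ultimately have "2 * K * s + s ^ 2 - 1 / 4 \<le> 0" by (simp add: power2_eq_square)
    then show ?thesis using pos 2 by simp
  next
    case 3
    define u where "u = - s"
    have u: "u > 0" using 3 by (simp add: u_def)
    have "u ^ 2 \<le> 2 * K * u + u ^ 4 / (2 * K)"
    proof (cases "u \<le> 2 * K")
      case True
      then have "u * u \<le> (2 * K) * u" using u by (intro mult_right_mono) auto
      moreover have "0 \<le> u ^ 4 / (2 * K)" using K by simp
      ultimately show ?thesis by (simp add: power2_eq_square)
    next
      case False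
      then have "2 * K \<le> u ^ 2" using K u by (smt (verit) power2_eq_square mult_le_cancel_right1)
      then have "2 * K * u ^ 2 \<le> u ^ 2 * u ^ 2" by (intro mult_right_mono) auto
      then have "u ^ 2 \<le> u ^ 4 / (2 * K)" using K by (simp add: field_simps power4_eq_xxxx power2_eq_square)
      then show ?thesis using K u by (smt (verit) mult_pos_pos)
    qed
    moreover have "\<not> s > 1 / (16 * K)" using 3 K by (smt (verit) divide_pos_pos)
    ultimately show ?thesis by (simp add: u_def)
  qed
qed

text \<open>
  A centred variable of unit variance has to take values of size one, and a bound on its fourth
  moment prevents these from being concentrated on a rare event; centring then forces
  a share of them to be positive. The proof integrates \<open>quartic_minorant\<close>, in which the coefficient
  \<open>1 / (2 * K)\<close> is chosen such that the quartic term costs at most half of the variance.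
\<close>

lemma (in prob_space) upper_deviation_from_fourth_moment:
  fixes S :: "'a \<Rightarrow> real"
  assumes [measurable]: "S \<in> borel_measurable M"
    and int: "integrable M (\<lambda>\<omega>. S \<omega> ^ 4)"
    and 1: "expectation S = 0" and 2: "expectation (\<lambda>\<omega>. S \<omega> ^ 2) = 1"
    and 4: "expectation (\<lambda>\<omega>. S \<omega> ^ 4) \<le> K" and K: "K \<ge> 1"
  shows "1 / (4 * (K ^ 2 + 2 * K)) \<le> prob {\<omega> \<in> space M. S \<omega> > 1 / (16 * K)}"
proof -
  let ?A = "{\<omega> \<in> space M. S \<omega> > 1 / (16 * K)}"
  have i: "integrable M S" "integrable M (\<lambda>\<omega>. S \<omega> ^ 2)"
    using integrable_lower_power[OF _ int, of 1] integrable_lower_power[OF _ int, of 2] by auto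
  have "1 / 4 \<le> 1 - expectation (\<lambda>\<omega>. S \<omega> ^ 4) / (2 * K) - 1 / 4"
    using 4 K by (simp add: field_simps)
  also have "\<dots> = expectation (\<lambda>\<omega>. 2 * K * S \<omega> + S \<omega> ^ 2 - S \<omega> ^ 4 / (2 * K) - 1 / 4)"
    using i int 1 2 by (simp add: prob_space)
  also have "\<dots> \<le> expectation (\<lambda>\<omega>. (K ^ 2 + 2 * K) * indicator ?A \<omega>)"
  proof (rule integral_mono)
    show "integrable M (\<lambda>\<omega>. 2 * K * S \<omega> + S \<omega> ^ 2 - S \<omega> ^ 4 / (2 * K) - 1 / 4)"
      using i int by simp
    show "integrable M (\<lambda>\<omega>. (K ^ 2 + 2 * K) * indicator ?A \<omega>)"
      by (intro integrable_mult_right integrable_real_indicator) (auto simp: emeasure_eq_measure)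
    show "2 * K * S \<omega> + S \<omega> ^ 2 - S \<omega> ^ 4 / (2 * K) - 1 / 4 \<le> (K ^ 2 + 2 * K) * indicator ?A \<omega>"
      if "\<omega> \<in> space M" for \<omega>
      using quartic_minorant[OF K, of "S \<omega>"] that by (auto simp: indicator_def simp del: divide_le_eq_1 split: if_splits)
  qed
  also have "\<dots> = (K ^ 2 + 2 * K) * prob ?A" by simp
  finally have "1 / 4 \<le> (K ^ 2 + 2 * K) * prob ?A" .
  moreover have "K ^ 2 + 2 * K > 0" using K by (simp add: add_pos_pos)
  ultimately show ?thesis by (simp add: field_simps)
qed

lemma indep_vars_PiM_coordinates:
  assumes P: "prob_space P" and "I \<noteq> {}" and f[measurable]: "f \<in> borel_measurable P"
  shows "prob_space.indep_vars (PiM I (\<lambda>_. P)) (\<lambda>_. borel) (\<lambda>i \<omega>. f (\<omega> i)) I"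
proof -
  interpret Q: prob_space "PiM I (\<lambda>_. P)" by (intro prob_space_PiM P)
  have "distr (PiM I (\<lambda>_. P)) (PiM I (\<lambda>_. P)) (\<lambda>\<omega>. \<lambda>i\<in>I. \<omega> i) = PiM I (\<lambda>_. P)"
    by (rule distr_cong[THEN trans, OF refl refl _ distr_id])
       (auto simp: space_PiM PiE_restrict)
  moreover have "PiM I (\<lambda>i. distr (PiM I (\<lambda>_. P)) P (\<lambda>\<omega>. \<omega> i)) = PiM I (\<lambda>_. P)"
    by (intro PiM_cong refl distr_PiM_component P)
  ultimately have "Q.indep_vars (\<lambda>_. P) (\<lambda>i \<omega>. \<omega> i) I"
    using \<open>I \<noteq> {}\<close> by (subst Q.indep_vars_iff_distr_eq_PiM') auto
  then show ?thesis
    by (rule Q.indep_vars_compose2) auto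
qed

lemma moments_PiM_sum:
  fixes f :: "'a \<Rightarrow> real"
  assumes P: "prob_space P" and I: "finite I" "I \<noteq> {}" and f: "f \<in> borel_measurable P"
    and int: "integrable P (\<lambda>x. f x ^ 4)" and mean: "integral\<^sup>L P f = 0"
  defines "m \<equiv> real (card I)" and "S \<equiv> \<lambda>\<omega>. \<Sum>i\<in>I. f (\<omega> i)"
    and "v \<equiv> integral\<^sup>L P (\<lambda>x. f x ^ 2)"
  shows "integrable (PiM I (\<lambda>_. P)) (\<lambda>\<omega>. S \<omega> ^ 4)" and "integral\<^sup>L (PiM I (\<lambda>_. P)) S = 0"
    and "integral\<^sup>L (PiM I (\<lambda>_. P)) (\<lambda>\<omega>. S \<omega> ^ 2) = m * v"
    and "integral\<^sup>L (PiM I (\<lambda>_. P)) (\<lambda>\<omega>. S \<omega> ^ 4) =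
      m * integral\<^sup>L P (\<lambda>x. f x ^ 4) + 3 * m * (m - 1) * v ^ 2"
proof -
  interpret Q: prob_space "PiM I (\<lambda>_. P)" by (intro prob_space_PiM P)
  have marginal: "integrable (PiM I (\<lambda>_. P)) (\<lambda>\<omega>. g (\<omega> i)) \<longleftrightarrow> integrable P g"
      "integral\<^sup>L (PiM I (\<lambda>_. P)) (\<lambda>\<omega>. g (\<omega> i)) = integral\<^sup>L P g"
    if "i \<in> I" and g: "g \<in> borel_measurable P" for i and g :: "'a \<Rightarrow> real"
    using integrable_distr_eq[of "\<lambda>\<omega>. \<omega> i" "PiM I (\<lambda>_. P)" P g]
      integral_distr[of "\<lambda>\<omega>. \<omega> i" "PiM I (\<lambda>_. P)" P g]
      distr_PiM_component[of I "\<lambda>_. P" i] that P by auto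
  have "integrable (PiM I (\<lambda>_. P)) (\<lambda>\<omega>. f (\<omega> i) ^ 4)" "Q.expectation (\<lambda>\<omega>. f (\<omega> i)) = 0"
    "Q.expectation (\<lambda>\<omega>. f (\<omega> i) ^ 2) = v"
    "Q.expectation (\<lambda>\<omega>. f (\<omega> i) ^ 4) = integral\<^sup>L P (\<lambda>x. f x ^ 4)" if "i \<in> I" for i
    using that f int mean marginal[OF that, of f] marginal[OF that, of "\<lambda>x. f x ^ 2"]
      marginal[OF that, of "\<lambda>x. f x ^ 4"] by (auto simp: v_def)
  note sums = Q.moments_indep_sum[OF I(1) indep_vars_PiM_coordinates[OF P I(2) f], OF this]
  show "integrable (PiM I (\<lambda>_. P)) (\<lambda>\<omega>. S \<omega> ^ 4)" "integral\<^sup>L (PiM I (\<lambda>_. P)) S = 0"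
    "integral\<^sup>L (PiM I (\<lambda>_. P)) (\<lambda>\<omega>. S \<omega> ^ 2) = m * v"
    "integral\<^sup>L (PiM I (\<lambda>_. P)) (\<lambda>\<omega>. S \<omega> ^ 4) =
      m * integral\<^sup>L P (\<lambda>x. f x ^ 4) + 3 * m * (m - 1) * v ^ 2"
    unfolding S_def m_def using sums by blast+
qed

text \<open>
  The constants do not depend on the number of summands: dividing the sum by its standard deviation
  \<open>sqrt (m * v)\<close> makes its fourth moment at most \<open>K4 / v\<^sup>2 + 3\<close> for every \<open>m\<close>, where \<open>v\<close> and \<open>K4\<close>
  are the second and fourth moment of \<open>f\<close>.
\<close>

lemma iid_sum_upper_deviation:
  fixes f :: "'a \<Rightarrow> real"
  assumes P: "prob_space P" and f[measurable]: "f \<in> borel_measurable P"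
    and int: "integrable P (\<lambda>x. f x ^ 4)" and mean: "integral\<^sup>L P f = 0"
    and v: "integral\<^sup>L P (\<lambda>x. f x ^ 2) > 0"
  obtains c t :: real where "c > 0" "t > 0"
    "\<And>I :: 'i set. finite I \<Longrightarrow> I \<noteq> {} \<Longrightarrow>
      c \<le> measure (PiM I (\<lambda>_. P)) {\<omega> \<in> space (PiM I (\<lambda>_. P)). t * sqrt (real (card I)) < (\<Sum>i\<in>I. f (\<omega> i))}"
proof -
  define v where "v = integral\<^sup>L P (\<lambda>x. f x ^ 2)"
  define K4 where "K4 = integral\<^sup>L P (\<lambda>x. f x ^ 4)"
  define K where "K = K4 / v ^ 2 + 3"
  have vpos: "v > 0" using v by (simp add: v_def)
  have K4: "K4 \<ge> 0" unfolding K4_def by (intro integral_nonneg_AE) auto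
  have K: "K \<ge> 1" using K4 by (simp add: K_def)
  show ?thesis
  proof (rule that)
    show "1 / (4 * (K ^ 2 + 2 * K)) > 0" using K by (simp add: add_pos_pos)
    show "sqrt v / (16 * K) > 0" using K vpos by simp
    fix I :: "'i set" assume I: "finite I" "I \<noteq> {}"
    interpret Q: prob_space "PiM I (\<lambda>_. P)" by (intro prob_space_PiM P)
    define m where "m = real (card I)"
    have m: "m \<ge> 1" using I by (simp add: m_def Suc_le_eq card_gt_0_iff)
    define S where "S = (\<lambda>\<omega>. \<Sum>i\<in>I. f (\<omega> i))"
    have [measurable]: "S \<in> borel_measurable (PiM I (\<lambda>_. P))" unfolding S_def by measurable
    have mom: "integrable (PiM I (\<lambda>_. P)) (\<lambda>\<omega>. S \<omega> ^ 4)" "Q.expectation S = 0"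
        "Q.expectation (\<lambda>\<omega>. S \<omega> ^ 2) = m * v"
        "Q.expectation (\<lambda>\<omega>. S \<omega> ^ 4) = m * K4 + 3 * m * (m - 1) * v ^ 2"
      using moments_PiM_sum[OF P I f int mean] unfolding S_def m_def v_def K4_def by auto
    define r where "r = sqrt (m * v)"
    have r: "r > 0" "r ^ 2 = m * v" using m vpos by (auto simp: r_def)
    have r4: "r ^ 4 = (m * v) ^ 2" unfolding r(2)[symmetric] by simp
    have "1 / (4 * (K ^ 2 + 2 * K)) \<le> Q.prob {\<omega> \<in> space (PiM I (\<lambda>_. P)). S \<omega> / r > 1 / (16 * K)}"
    proof (rule Q.upper_deviation_from_fourth_moment[OF _ _ _ _ _ K])
      show "integrable (PiM I (\<lambda>_. P)) (\<lambda>\<omega>. (S \<omega> / r) ^ 4)" using mom(1) by (simp add: power_divide)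
      show "Q.expectation (\<lambda>\<omega>. S \<omega> / r) = 0" using mom(2) by simp
      show "Q.expectation (\<lambda>\<omega>. (S \<omega> / r) ^ 2) = 1" using mom(3) r m vpos by (simp add: power_divide)
      have K_eq: "K * (m * v) ^ 2 = m * m * K4 + 3 * m * m * v ^ 2"
        using vpos by (simp add: K_def field_simps power2_eq_square)
      have "m * K4 \<le> m * m * K4" using m K4 by (intro mult_right_mono) auto
      moreover have "3 * m * (m - 1) * v ^ 2 \<le> 3 * m * m * v ^ 2"
        using m by (intro mult_right_mono mult_left_mono) auto
      ultimately have "m * K4 + 3 * m * (m - 1) * v ^ 2 \<le> K * (m * v) ^ 2"
        using K_eq by linarith
      then show "Q.expectation (\<lambda>\<omega>. (S \<omega> / r) ^ 4) \<le> K"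
        using mom(4) m vpos by (simp add: power_divide r4 divide_le_eq)
    qed simp
    also have "(\<lambda>\<omega>. S \<omega> / r > 1 / (16 * K)) = (\<lambda>\<omega>. sqrt v / (16 * K) * sqrt m < S \<omega>)"
      using r(1) K by (auto simp: fun_eq_iff r_def real_sqrt_mult field_simps)
    finally show "1 / (4 * (K ^ 2 + 2 * K)) \<le> Q.prob {\<omega> \<in> space (PiM I (\<lambda>_. P)).
        sqrt v / (16 * K) * sqrt (real (card I)) < (\<Sum>i\<in>I. f (\<omega> i))}"
      by (simp add: S_def m_def)
  qed
qed

section \<open>The norm of a Gaussian vector\<close>

definition std_normal :: "real measure" where
  "std_normal = density lborel (\<lambda>x. ennreal (std_normal_density x))"

lemma sets_std_normal [simp, measurable_cong]: "sets std_normal = sets borel"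
  and space_std_normal [simp]: "space std_normal = UNIV"
  by (simp_all add: std_normal_def)

lemma prob_space_std_normal: "prob_space std_normal"
  unfolding std_normal_def by (rule prob_space_normal_density) simp

lemma sets_std_gauss [simp, measurable_cong]: "sets (std_gauss :: 'a::euclidean_space measure) = sets borel"
  and space_std_gauss [simp]: "space (std_gauss :: 'a::euclidean_space measure) = UNIV"
  by (simp_all add: std_gauss_def)

text \<open>
  The coordinates of a standard Gaussian vector are independent standard normal variables. This
  reduces the moments of its squared norm to those of a sum over \<open>Basis\<close>, to which
  \<open>moments_PiM_sum\<close> applies.
\<close>

lemma distr_std_gauss_coordinates:
  "distr (std_gauss :: 'a::euclidean_space measure) (PiM Basis (\<lambda>_. std_normal))
     (\<lambda>z. \<lambda>b\<in>Basis. z \<bullet> b) = PiM Basis (\<lambda>_. std_normal)"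
proof -
  interpret product_prob_space "\<lambda>_ :: 'a. std_normal" Basis
    by (intro product_prob_spaceI prob_space_std_normal)
  have [measurable]: "(\<lambda>z. \<lambda>b\<in>Basis. z \<bullet> b) \<in> std_gauss \<rightarrow>\<^sub>M PiM Basis (\<lambda>_ :: 'a. std_normal)"
    by (intro measurable_restrict) simp
  show ?thesis
  proof (rule PiM_eqI)
    fix A :: "'a \<Rightarrow> real set"
    assume "\<And>b. b \<in> Basis \<Longrightarrow> A b \<in> sets std_normal"
    then have A[measurable]: "A b \<in> sets borel" if "b \<in> Basis" for b using that by simp
    have box: "(\<lambda>z. \<lambda>b\<in>Basis. z \<bullet> b) -` (PiE Basis A) = {z :: 'a. \<forall>b\<in>Basis. z \<bullet> b \<in> A b}"
      by (auto simp: PiE_iff)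
    have [measurable]: "{z :: 'a. \<forall>b\<in>Basis. z \<bullet> b \<in> A b} \<in> sets borel"
      by measurable
    have "emeasure (distr std_gauss (PiM Basis (\<lambda>_. std_normal)) (\<lambda>z. \<lambda>b\<in>Basis. z \<bullet> b)) (PiE Basis A) =
        emeasure std_gauss {z. \<forall>b\<in>Basis. z \<bullet> b \<in> A b}"
      by (subst emeasure_distr) (auto intro!: sets_PiM_I_finite simp: A box)
    also have "\<dots> = (\<integral>\<^sup>+ z. ennreal (\<Prod>b\<in>Basis. std_normal_density (z \<bullet> b)) *
        indicator {z. \<forall>b\<in>Basis. z \<bullet> b \<in> A b} z \<partial>lborel)"
      unfolding std_gauss_def by (rule emeasure_density) auto
    also have "\<dots> = (\<integral>\<^sup>+ z. (\<Prod>b\<in>Basis. ennreal (std_normal_density (z \<bullet> b)) * indicator (A b) (z \<bullet> b)) \<partial>lborel)"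
    proof (rule nn_integral_cong)
      fix z :: 'a
      have "(\<Prod>b\<in>Basis. indicator (A b) (z \<bullet> b)) = (indicator {z. \<forall>b\<in>Basis. z \<bullet> b \<in> A b} z :: ennreal)"
        by (auto simp: indicator_def)
      then show "ennreal (\<Prod>b\<in>Basis. std_normal_density (z \<bullet> b)) * indicator {z. \<forall>b\<in>Basis. z \<bullet> b \<in> A b} z =
          (\<Prod>b\<in>Basis. ennreal (std_normal_density (z \<bullet> b)) * indicator (A b) (z \<bullet> b))"
        by (simp add: prod.distrib prod_ennreal)
    qed
    also have "\<dots> = (\<Prod>b\<in>Basis. \<integral>\<^sup>+ x. ennreal (std_normal_density x) * indicator (A b) x \<partial>lborel)"
      by (rule nn_integral_lborel_prod) auto
    also have "\<dots> = (\<Prod>b\<in>Basis. emeasure std_normal (A b))"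
      by (intro prod.cong refl) (simp add: std_normal_def emeasure_density)
    finally show "emeasure (distr std_gauss (PiM Basis (\<lambda>_. std_normal)) (\<lambda>z. \<lambda>b\<in>Basis. z \<bullet> b)) (PiE Basis A) =
        (\<Prod>b\<in>Basis. emeasure std_normal (A b))" .
  qed simp_all
qed

lemma prob_space_std_gauss: "prob_space (std_gauss :: 'a::euclidean_space measure)"
proof (rule prob_space_distrD)
  show "(\<lambda>z. \<lambda>b\<in>Basis. z \<bullet> b) \<in> std_gauss \<rightarrow>\<^sub>M PiM Basis (\<lambda>_ :: 'a. std_normal)"
    by (intro measurable_restrict) simp
  show "prob_space (distr std_gauss (PiM Basis (\<lambda>_. std_normal)) (\<lambda>z :: 'a. \<lambda>b\<in>Basis. z \<bullet> b))"
    unfolding distr_std_gauss_coordinates by (intro prob_space_PiM prob_space_std_normal)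
qed

lemma std_normal_square_moments:
  "integral\<^sup>L std_normal (\<lambda>x. x\<^sup>2 - 1) = 0"
  "integral\<^sup>L std_normal (\<lambda>x. (x\<^sup>2 - 1) ^ 2) = 2"
  "integrable std_normal (\<lambda>x. (x\<^sup>2 - 1) ^ 4)"
proof -
  interpret prob_space std_normal by (rule prob_space_std_normal)
  have int: "integrable std_normal (\<lambda>x. x ^ k)" for k
    unfolding std_normal_def using integrable_std_normal_moment[of k]
    by (subst integrable_density) auto
  have mom: "integral\<^sup>L std_normal (\<lambda>x. x ^ (2 * k)) = fact (2 * k) / (2 ^ k * fact k)" for k
    unfolding std_normal_def using integral_std_normal_moment_even[of k]
    by (subst integral_density) auto
  have m2: "integral\<^sup>L std_normal (\<lambda>x. x ^ 2) = 1" using mom[of 1] by simp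
  have m4: "integral\<^sup>L std_normal (\<lambda>x. x ^ 4) = 3" using mom[of 2] by (simp add: fact_numeral)
  show "integral\<^sup>L std_normal (\<lambda>x. x\<^sup>2 - 1) = 0" using int m2 by (simp add: prob_space[unfolded space_std_normal])
  have p2: "(x\<^sup>2 - 1) ^ 2 = x ^ 4 - 2 * x ^ 2 + 1" for x :: real
    by (simp add: power2_eq_square power4_eq_xxxx algebra_simps)
  show "integral\<^sup>L std_normal (\<lambda>x. (x\<^sup>2 - 1) ^ 2) = 2"
    unfolding p2 using int m2 m4 by (simp add: prob_space[unfolded space_std_normal])
  have p4: "(x\<^sup>2 - 1) ^ 4 = x ^ 8 - 4 * x ^ 6 + 6 * x ^ 4 - 4 * x ^ 2 + 1" for x :: real
  proof -
    have "(x\<^sup>2 - 1) ^ 4 = ((x\<^sup>2 - 1) ^ 2) ^ 2" by simp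
    also have "\<dots> = (x ^ 4 - 2 * x ^ 2 + 1) ^ 2" unfolding p2 ..
    also have "\<dots> = x ^ 8 - 4 * x ^ 6 + 6 * x ^ 4 - 4 * x ^ 2 + 1"
      by (simp add: eval_nat_numeral algebra_simps)
    finally show ?thesis .
  qed
  show "integrable std_normal (\<lambda>x. (x\<^sup>2 - 1) ^ 4)"
    unfolding p4 using int by simp
qed

lemma std_gauss_norm_moments:
  fixes d :: real
  defines "d \<equiv> real DIM('a::euclidean_space)"
  shows "integral\<^sup>L std_gauss (\<lambda>z :: 'a. (norm z)\<^sup>2 - d) = 0"
    and "integral\<^sup>L std_gauss (\<lambda>z :: 'a. ((norm z)\<^sup>2 - d) ^ 2) = 2 * d"
    and "integrable std_gauss (\<lambda>z :: 'a. ((norm z)\<^sup>2 - d) ^ 4)"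
proof -
  let ?P = "PiM Basis (\<lambda>_ :: 'a. std_normal)" and ?c = "\<lambda>z :: 'a. \<lambda>b\<in>Basis. z \<bullet> b"
  let ?S = "\<lambda>\<omega> :: 'a \<Rightarrow> real. \<Sum>b\<in>Basis. (\<omega> b)\<^sup>2 - 1"
  have c[measurable]: "?c \<in> std_gauss \<rightarrow>\<^sub>M ?P"
    by (intro measurable_restrict) simp
  have S: "?S (?c z) = (norm z)\<^sup>2 - d" for z
  proof -
    have "(norm z)\<^sup>2 = (\<Sum>b\<in>Basis. (z \<bullet> b)\<^sup>2)"
      using euclidean_inner[of z z] unfolding power2_norm_eq_inner[symmetric] power2_eq_square[symmetric] .
    then show ?thesis by (simp add: d_def sum_subtractf)
  qed
  note mom = moments_PiM_sum[where I = "Basis :: 'a set" and f = "\<lambda>x. x\<^sup>2 - 1",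
      OF prob_space_std_normal finite_Basis nonempty_Basis _ std_normal_square_moments(3,1), simplified]
  have "integral\<^sup>L std_gauss (\<lambda>z :: 'a. ?S (?c z) ^ k) = integral\<^sup>L ?P (\<lambda>\<omega>. ?S \<omega> ^ k)" for k
    using integral_distr[of ?c std_gauss ?P "\<lambda>\<omega>. ?S \<omega> ^ k"]
    unfolding distr_std_gauss_coordinates by simp
  note int = this[unfolded S]
  show "integral\<^sup>L std_gauss (\<lambda>z :: 'a. (norm z)\<^sup>2 - d) = 0"
    using int[of 1] mom(2) by simp
  show "integral\<^sup>L std_gauss (\<lambda>z :: 'a. ((norm z)\<^sup>2 - d) ^ 2) = 2 * d"
    using int[of 2] mom(3) std_normal_square_moments(2) by (simp add: d_def)
  have "integrable std_gauss (\<lambda>z :: 'a. ?S (?c z) ^ 4)"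
    using integrable_distr_eq[of ?c std_gauss ?P "\<lambda>\<omega>. ?S \<omega> ^ 4"] mom(1)
    unfolding distr_std_gauss_coordinates by simp
  then show "integrable std_gauss (\<lambda>z :: 'a. ((norm z)\<^sup>2 - d) ^ 4)"
    unfolding S .
qed

section \<open>Measurability in the matrix space\<close>

lemma sets_mborel: "sets (mborel m) = sigma_sets (mspace m) {U. openin (mtopology_of m) U}"
  and space_mborel [simp]: "space (mborel m) = mspace m"
  unfolding mborel_def by (auto intro!: sets_measure_of space_measure_of dest: openin_subset[THEN subsetD])

lemma frobenius_dist_eq:
  assumes "X \<in> carrier_mat N n" "Y \<in> carrier_mat N n"
  shows "frobenius_dist X Y = L2_set (\<lambda>ij. norm (X $$ ij - Y $$ ij)) ({..<N} \<times> {..<n})"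
  using assms by (auto simp: frobenius_dist_def frobenius_norm_altdef intro!: L2_set_cong)

lemma frobenius_norm_triangle:
  assumes "X \<in> carrier_mat N n" "Y \<in> carrier_mat N n"
  shows "frobenius_norm X \<le> frobenius_norm Y + frobenius_dist X Y"
proof -
  have "frobenius_norm X \<le> L2_set (\<lambda>ij. norm (Y $$ ij) + norm (X $$ ij - Y $$ ij)) ({..<N} \<times> {..<n})"
    using assms by (auto simp: frobenius_norm_altdef intro!: L2_set_mono norm_triangle_sub)
  also have "\<dots> \<le> frobenius_norm Y + frobenius_dist X Y"
    unfolding frobenius_dist_eq[OF assms] using assms
    by (auto simp: frobenius_norm_altdef intro: L2_set_triangle_ineq)
  finally show ?thesis .
qed

text \<open>
  The value of \<open>mat_gauss\<close> on a set can be computed as the product measure of a preimage only because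
  this map is measurable. Preimages of open sets of matrices are open in the product topology on all functions
  of index pairs, and as there are countably many index pairs
  and the scalars are second countable, the Borel sets of that topology are the
  product measurable ones. Extending families on \<open>{..<N} \<times> {..<n}\<close> by \<open>0\<close> carries this over to the
  finite product.
\<close>

lemma measurable_mat:
  "mat N n \<in> PiM ({..<N} \<times> {..<n}) (\<lambda>_. std_gauss :: 'a::conj_division_algebra measure) \<rightarrow>\<^sub>M
     mborel (mat_metric N n)"
  unfolding mborel_def
proof (rule measurable_measure_of)
  let ?I = "{..<N} \<times> {..<n}"
  let ?m = "mat_metric N n :: 'a mat metric"
  interpret Metric_space "carrier_mat N n :: 'a mat set" frobenius_dist
    by (rule Metric_space_mat)
  show "{U. openin (mtopology_of ?m) U} \<subseteq> Pow (mspace ?m)"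
    by (auto dest: openin_subset[THEN subsetD])
  show "mat N n \<in> space (PiM ?I (\<lambda>_. std_gauss :: 'a measure)) \<rightarrow> mspace ?m"
    by simp
  fix U assume "U \<in> {U. openin (mtopology_of ?m) U}"
  then have U: "openin mtopology U" by (simp add: mat_metric_def)
  have "open {f :: nat \<times> nat \<Rightarrow> 'a. mat N n f \<in> U}"
  proof (subst open_subopen, safe)
    fix f :: "nat \<times> nat \<Rightarrow> 'a" assume "mat N n f \<in> U"
    then obtain r where r: "r > 0" "mball (mat N n f) r \<subseteq> U"
      using U unfolding openin_mtopology by blast
    have d: "frobenius_dist (mat N n f) (mat N n g) = L2_set (\<lambda>ij. norm (f ij - g ij)) ?I" for g :: "nat \<times> nat \<Rightarrow> 'a"
      by (subst frobenius_dist_eq[of _ N n]) (auto intro!: L2_set_cong)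
    let ?T = "{g. L2_set (\<lambda>ij. norm (f ij - g ij)) ?I < r}"
    have "open ?T"
      unfolding L2_set_def
      by (intro open_Collect_less continuous_intros continuous_on_product_coordinates)
    moreover have "f \<in> ?T" using r by (simp add: L2_set_def)
    moreover have "?T \<subseteq> {f. mat N n f \<in> U}"
      using r(2) by (auto simp: subset_iff d[symmetric])
    ultimately show "\<exists>T. open T \<and> f \<in> T \<and> T \<subseteq> {f. mat N n f \<in> U}" by blast
  qed
  then have O: "{f. mat N n f \<in> U} \<in> sets (PiM UNIV (\<lambda>_ :: nat \<times> nat. borel :: 'a measure))"
    unfolding sets_PiM_equal_borel by simp
  let ?e = "\<lambda>(f :: nat \<times> nat \<Rightarrow> 'a) ij. if ij \<in> ?I then f ij else 0"
  have "?e \<in> PiM ?I (\<lambda>_. std_gauss) \<rightarrow>\<^sub>M PiM UNIV (\<lambda>_. borel)"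
  proof (rule measurable_PiM_single')
    fix ij :: "nat \<times> nat"
    show "(\<lambda>f. ?e f ij) \<in> PiM ?I (\<lambda>_. std_gauss) \<rightarrow>\<^sub>M borel"
      by (cases "ij \<in> ?I") (simp_all del: mem_Sigma_iff)
  qed auto
  from measurable_sets[OF this O]
  have "?e -` {f. mat N n f \<in> U} \<inter> space (PiM ?I (\<lambda>_. std_gauss :: 'a measure)) \<in> sets (PiM ?I (\<lambda>_. std_gauss))" .
  also have "mat N n (?e f) = mat N n f" for f
    by (rule eq_matI) auto
  then have "?e -` {f. mat N n f \<in> U} = mat N n -` U" by (auto simp del: mem_Sigma_iff)
  finally show "mat N n -` U \<inter> space (PiM ?I (\<lambda>_. std_gauss :: 'a measure)) \<in> sets (PiM ?I (\<lambda>_. std_gauss))" .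
qed

lemma prob_space_mat_gauss: "prob_space (mat_gauss N n :: 'a::conj_division_algebra mat measure)"
  unfolding mat_gauss_def
  by (intro prob_space.prob_space_distr prob_space_PiM prob_space_std_gauss measurable_mat)

lemma sets_frobenius_norm_gt:
  "{Z \<in> carrier_mat N n. frobenius_norm Z > r} \<in> sets (mborel (mat_metric N n :: 'a::conj_division_algebra mat metric))"
proof -
  interpret Metric_space "carrier_mat N n :: 'a mat set" frobenius_dist
    by (rule Metric_space_mat)
  have "openin mtopology {Z \<in> carrier_mat N n :: 'a mat set. frobenius_norm Z > r}"
    unfolding openin_mtopology
  proof safe
    fix Z :: "'a mat" assume Z: "Z \<in> carrier_mat N n" "frobenius_norm Z > r"
    have "mball Z (frobenius_norm Z - r) \<subseteq> {Z \<in> carrier_mat N n. frobenius_norm Z > r}"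
    proof safe
      fix W assume W: "W \<in> mball Z (frobenius_norm Z - r)"
      then show "W \<in> carrier_mat N n" by simp
      then show "frobenius_norm W > r" using frobenius_norm_triangle[of Z N n W] Z W by simp
    qed
    then show "\<exists>e>0. mball Z e \<subseteq> {Z \<in> carrier_mat N n. frobenius_norm Z > r}"
      using Z by (intro exI[of _ "frobenius_norm Z - r"]) simp
  qed
  then show ?thesis unfolding sets_mborel by (auto simp: mat_metric_def intro!: sigma_sets.Basic)
qed

section \<open>The Gaussian measure far from the Stiefel manifold\<close>

text \<open>
  A deviation of the squared norm of order \<open>sqrt d\<close> above its mean \<open>d\<close> is a deviation of constant
  order of the norm above \<open>sqrt d\<close>. The anticoncentration bound is used with the matrix entries,
  rather than their real coordinates, as the independent summands.
\<close>

lemma gaussian_norm_upper_deviation: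
  obtains c \<epsilon> :: real where "c > 0" "\<epsilon> > 0"
    "\<And>N n. 1 \<le> N \<Longrightarrow> 1 \<le> n \<Longrightarrow>
      c \<le> measure (mat_gauss N n :: 'a::conj_division_algebra mat measure)
        {Z \<in> carrier_mat N n. frobenius_norm Z > sqrt (real (N * n * DIM('a))) + \<epsilon>}"
proof -
  define d where "d = real DIM('a)"
  have d: "d > 0" by (simp add: d_def)
  obtain c t :: real where c: "c > 0" and t: "t > 0" and
    dev: "\<And>I :: (nat \<times> nat) set. finite I \<Longrightarrow> I \<noteq> {} \<Longrightarrow>
      c \<le> measure (PiM I (\<lambda>_. std_gauss)) {\<omega> \<in> space (PiM I (\<lambda>_. std_gauss)).
        t * sqrt (real (card I)) < (\<Sum>i\<in>I. (norm (\<omega> i :: 'a))\<^sup>2 - d)}"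
    using iid_sum_upper_deviation[OF prob_space_std_gauss, of "\<lambda>z :: 'a. (norm z)\<^sup>2 - d"]
      std_gauss_norm_moments[where 'a = 'a] d unfolding d_def[symmetric] by auto
  \<comment> \<open>Chosen such that \<open>2 * \<epsilon> * sqrt (m * d) + \<epsilon>\<^sup>2 \<le> t * sqrt m\<close> for all \<open>m \<ge> 1\<close>.\<close>
  define \<epsilon> where "\<epsilon> = min 1 (t / (2 * sqrt d + 1))"
  have sd: "2 * sqrt d + 1 > 0" using real_sqrt_ge_zero[of d] d by linarith
  have \<epsilon>: "\<epsilon> > 0" using t sd by (simp add: \<epsilon>_def)
  have \<epsilon>t: "\<epsilon> * (2 * sqrt d + 1) \<le> t" using sd by (simp add: \<epsilon>_def flip: pos_le_divide_eq)
  show thesis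
  proof (rule that[OF c \<epsilon>])
    fix N n :: nat assume Nn: "1 \<le> N" "1 \<le> n"
    let ?I = "{..<N} \<times> {..<n}"
    let ?P = "PiM ?I (\<lambda>_. std_gauss :: 'a measure)"
    let ?A = "{Z \<in> carrier_mat N n :: 'a mat set. frobenius_norm Z > sqrt (real (N * n * DIM('a))) + \<epsilon>}"
    interpret P: prob_space ?P by (intro prob_space_PiM prob_space_std_gauss)
    define m where "m = real (card ?I)"
    have m: "m = real (N * n)" by (simp add: m_def)
    then have m1: "m \<ge> 1" using Nn by (simp add: Suc_le_eq flip: of_nat_mult)
    have "(0, 0) \<in> ?I" using Nn by simp
    then have ne: "?I \<noteq> {}" by blast
    have norm_mat: "frobenius_norm (mat N n \<omega>) = sqrt (\<Sum>i\<in>?I. (norm (\<omega> i))\<^sup>2)" for \<omega> :: "nat \<times> nat \<Rightarrow> 'a"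
      by (auto simp: frobenius_norm_altdef L2_set_def intro!: sum.cong)
    have impl: "frobenius_norm (mat N n \<omega>) > sqrt (real (N * n * DIM('a))) + \<epsilon>"
      if "t * sqrt m < (\<Sum>i\<in>?I. (norm (\<omega> i))\<^sup>2 - d)" for \<omega> :: "nat \<times> nat \<Rightarrow> 'a"
    proof -
      have sq: "(x + e)\<^sup>2 = x\<^sup>2 + e * (2 * x + e)" for x e :: real
        by (simp add: power2_eq_square algebra_simps)
      have md: "real (N * n * DIM('a)) = m * d" by (simp add: m d_def)
      have sqrt_md: "(sqrt (m * d))\<^sup>2 = m * d" "sqrt (m * d) = sqrt d * sqrt m"
        using d m1 by (auto intro!: real_sqrt_pow2 mult_nonneg_nonneg) (simp only: real_sqrt_mult mult.commute)
      have "(sqrt (m * d) + \<epsilon>)\<^sup>2 = m * d + \<epsilon> * (2 * sqrt (m * d) + \<epsilon>)"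
        unfolding sq sqrt_md(1) ..
      also have "\<dots> = m * d + \<epsilon> * (2 * (sqrt d * sqrt m) + \<epsilon>)"
        unfolding sqrt_md(2) ..
      also have "\<dots> \<le> m * d + \<epsilon> * (2 * (sqrt d * sqrt m) + sqrt m)"
        using \<epsilon> m1 by (intro add_left_mono mult_left_mono) (auto simp: \<epsilon>_def min_le_iff_disj)
      also have "\<dots> = m * d + \<epsilon> * (2 * sqrt d + 1) * sqrt m" by (simp add: algebra_simps)
      also have "\<dots> \<le> m * d + t * sqrt m"
        using \<epsilon>t m1 by (intro add_left_mono mult_right_mono) auto
      also have "\<dots> < (\<Sum>i\<in>?I. (norm (\<omega> i))\<^sup>2)"
        using that by (simp add: sum_subtractf m)
      finally show ?thesis unfolding norm_mat md by (rule real_less_rsqrt)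
    qed
    have "c \<le> P.prob {\<omega> \<in> space ?P. t * sqrt m < (\<Sum>i\<in>?I. (norm (\<omega> i))\<^sup>2 - d)}"
      unfolding m_def by (rule dev) (use ne in auto)
    also have "\<dots> \<le> P.prob (mat N n -` ?A \<inter> space ?P)"
    proof (rule P.finite_measure_mono)
      show "{\<omega> \<in> space ?P. t * sqrt m < (\<Sum>i\<in>?I. (norm (\<omega> i))\<^sup>2 - d)} \<subseteq> mat N n -` ?A \<inter> space ?P"
        using impl by auto
      show "mat N n -` ?A \<inter> space ?P \<in> sets ?P"
        by (rule measurable_sets[OF measurable_mat sets_frobenius_norm_gt])
    qed
    also have "\<dots> = measure (mat_gauss N n) ?A"
      unfolding mat_gauss_def by (rule measure_distr[OF measurable_mat sets_frobenius_norm_gt, symmetric])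
    finally show "c \<le> measure (mat_gauss N n) ?A" .
  qed
qed

lemma frobenius_norm_rescaled_stiefel:
  fixes Z :: "'a::conj_division_algebra mat"
  assumes Z: "Z \<in> stiefel N n" and r: "r \<ge> 0"
  shows "frobenius_norm (of_real r \<cdot>\<^sub>m Z) = r * sqrt (real n)"
proof -
  have Zc: "Z \<in> carrier_mat N n" and ZZ: "conj_transpose Z * Z = 1\<^sub>m n"
    using Z by (auto simp: stiefel_def)
  have "frobenius_norm (of_real r \<cdot>\<^sub>m Z) = L2_set (\<lambda>ij. r * norm (Z $$ ij)) ({..<N} \<times> {..<n})"
    using Zc r by (auto simp: frobenius_norm_altdef norm_mult intro!: L2_set_cong)
  also have "\<dots> = r * frobenius_norm Z"
    using Zc r by (simp add: frobenius_norm_altdef L2_set_right_distrib)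
  also have "frobenius_norm Z = sqrt (real n)"
  proof -
    have "mat_trace (1\<^sub>m n :: 'a mat) = real n *\<^sub>R 1"
      by (simp add: mat_trace_def scaleR_conv_of_real)
    then show ?thesis
      unfolding frobenius_norm_def ZZ by (simp add: dot_square_norm)
  qed
  finally show ?thesis .
qed

text \<open>
  If the measures of the preimages under \<open>f\<close> do not define a measure on \<open>N\<close>, then \<open>distr\<close> is by
  definition the null measure; otherwise \<open>A\<close> gets the measure of its empty preimage, or \<open>0\<close> if it is
  not in \<open>sets N\<close>.
\<close>

lemma measure_distr_eq_0:
  assumes "f -` A \<inter> space M = {}"
  shows "measure (distr M N f) A = 0"
  unfolding measure_def distr_def emeasure_measure_of_conv using assms by simp

text \<open>
  A radius \<open>\<delta> < \<epsilon>\<close> in the defining set has to satisfy \<open>0 \<ge> c - \<delta>\<close>. That \<open>\<nu>\<close> is a probability measure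
  puts the radius \<open>1\<close> into that set, whose infimum would otherwise be an unspecified number.
\<close>

lemma prohorov_dist_ge:
  assumes \<nu>: "prob_space \<nu>" and A: "A \<in> sets (mborel m)" and c: "c \<le> measure \<nu> A"
    and sep: "\<And>\<delta>. 0 < \<delta> \<Longrightarrow> \<delta> < \<epsilon> \<Longrightarrow> measure \<mu> (mthicken m \<delta> A) = 0"
  shows "min c \<epsilon> \<le> prohorov_dist m \<mu> \<nu>"
  unfolding prohorov_dist_def
proof (rule cInf_greatest)
  have "measure \<nu> B - 1 \<le> measure \<mu> (mthicken m 1 B)" for B
    using prob_space.prob_le_1[OF \<nu>, of B] measure_nonneg[of \<mu> "mthicken m 1 B"] by linarith
  then show "{\<delta>. 0 < \<delta> \<and> (\<forall>A\<in>sets (mborel m). measure \<nu> A - \<delta> \<le> measure \<mu> (mthicken m \<delta> A))} \<noteq> {}"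
    by (auto intro!: exI[of _ 1])
  fix \<delta> assume "\<delta> \<in> {\<delta>. 0 < \<delta> \<and> (\<forall>A\<in>sets (mborel m). measure \<nu> A - \<delta> \<le> measure \<mu> (mthicken m \<delta> A))}"
  then have "0 < \<delta>" "measure \<nu> A - \<delta> \<le> measure \<mu> (mthicken m \<delta> A)" using A by auto
  then show "min c \<epsilon> \<le> \<delta>" using sep[of \<delta>] c by (cases "\<delta> < \<epsilon>") auto
qed

text \<open>
  The Gaussian test set stays away from the whole manifold, so its thickenings by less than \<open>\<epsilon>\<close>
  do not meet the support of the rescaled Haar measure.
\<close>

lemma prohorov_dist_stiefel_gauss_ge:
  obtains c :: real where "c > 0"
    "\<And>N n (\<sigma> :: 'a::conj_division_algebra mat measure). 1 \<le> N \<Longrightarrow> 1 \<le> n \<Longrightarrow> is_stiefel_haar N n \<sigma> \<Longrightarrow>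
      c \<le> prohorov_dist (mat_metric N n) (rescale_stiefel N n \<sigma>) (mat_gauss N n)"
proof -
  obtain c \<epsilon> :: real where c: "c > 0" and \<epsilon>: "\<epsilon> > 0" and
    dev: "\<And>N n. 1 \<le> N \<Longrightarrow> 1 \<le> n \<Longrightarrow> c \<le> measure (mat_gauss N n :: 'a mat measure)
        {Z \<in> carrier_mat N n. frobenius_norm Z > sqrt (real (N * n * DIM('a))) + \<epsilon>}"
    using gaussian_norm_upper_deviation[where 'a = 'a] by blast
  show thesis
  proof (rule that)
    show "min c \<epsilon> > 0" using c \<epsilon> by simp
    fix N n and \<sigma> :: "'a mat measure"
    assume Nn: "1 \<le> N" "1 \<le> n" and \<sigma>: "is_stiefel_haar N n \<sigma>"
    let ?A = "{Z \<in> carrier_mat N n :: 'a mat set. frobenius_norm Z > sqrt (real (N * n * DIM('a))) + \<epsilon>}"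
    define r where "r = sqrt (real (N * DIM('a)) - 1)"
    have "space \<sigma> = space (mborel (submetric (mat_metric N n) (stiefel N n)))"
      using \<sigma> unfolding is_stiefel_haar_def by (intro sets_eq_imp_space_eq) blast
    then have space: "space \<sigma> = stiefel N n"
      by (auto simp: stiefel_def)
    have ND: "real (N * DIM('a)) \<ge> 1" using Nn by (simp add: Suc_le_eq del: of_nat_mult)
    have norm: "frobenius_norm (of_real r \<cdot>\<^sub>m Z) \<le> sqrt (real (N * n * DIM('a)))"
      if "Z \<in> stiefel N n" for Z :: "'a mat"
    proof -
      have "frobenius_norm (of_real r \<cdot>\<^sub>m Z) = r * sqrt (real n)"
        using that ND by (intro frobenius_norm_rescaled_stiefel) (auto simp: r_def)
      also have "\<dots> \<le> sqrt (real (N * DIM('a))) * sqrt (real n)"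
        unfolding r_def by (intro mult_right_mono) auto
      finally show ?thesis by (simp add: real_sqrt_mult ac_simps)
    qed
    show "min c \<epsilon> \<le> prohorov_dist (mat_metric N n) (rescale_stiefel N n \<sigma>) (mat_gauss N n)"
    proof (rule prohorov_dist_ge[OF prob_space_mat_gauss sets_frobenius_norm_gt dev[OF Nn]])
      fix \<delta> assume \<delta>: "0 < \<delta>" "\<delta> < \<epsilon>"
      have "of_real r \<cdot>\<^sub>m Z \<notin> mthicken (mat_metric N n) \<delta> ?A" if "Z \<in> stiefel N n" for Z :: "'a mat"
      proof
        assume "of_real r \<cdot>\<^sub>m Z \<in> mthicken (mat_metric N n) \<delta> ?A"
        then obtain W where W: "W \<in> ?A" "frobenius_dist (of_real r \<cdot>\<^sub>m Z) W < \<delta>"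
          and Zc: "of_real r \<cdot>\<^sub>m Z \<in> carrier_mat N n"
          by (auto simp: mthicken_def INF_less_iff)
        have "frobenius_norm W \<le> frobenius_norm (of_real r \<cdot>\<^sub>m Z) + frobenius_dist W (of_real r \<cdot>\<^sub>m Z)"
          using W Zc by (intro frobenius_norm_triangle) auto
        also have "frobenius_dist W (of_real r \<cdot>\<^sub>m Z) = frobenius_dist (of_real r \<cdot>\<^sub>m Z) W"
          by (rule Metric_space.commute[OF Metric_space_mat])
        finally show False using W \<delta> norm[OF that] by auto
      qed
      then show "measure (rescale_stiefel N n \<sigma>) (mthicken (mat_metric N n) \<delta> ?A) = 0"
        unfolding rescale_stiefel_def r_def[symmetric] by (intro measure_distr_eq_0) (auto simp: space)
    qed
  qed
qed

theorem theorem1p4: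
  fixes n :: "nat \<Rightarrow> nat"
  assumes "\<And>N. N \<ge> 1 \<Longrightarrow> 1 \<le> n N \<and> n N \<le> N"
  shows
    "(\<exists>c>0. \<forall>N\<ge>1. \<forall>\<sigma> :: real mat measure. is_stiefel_haar N (n N) \<sigma> \<longrightarrow>
        prohorov_dist (mat_metric N (n N)) (rescale_stiefel N (n N) \<sigma>) (mat_gauss N (n N)) \<ge> c) \<and>
     (\<exists>c>0. \<forall>N\<ge>1. \<forall>\<sigma> :: complex mat measure. is_stiefel_haar N (n N) \<sigma> \<longrightarrow>
        prohorov_dist (mat_metric N (n N)) (rescale_stiefel N (n N) \<sigma>) (mat_gauss N (n N)) \<ge> c) \<and>
     (\<exists>c>0. \<forall>N\<ge>1. \<forall>\<sigma> :: quat mat measure. is_stiefel_haar N (n N) \<sigma> \<longrightarrow>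
        prohorov_dist (mat_metric N (n N)) (rescale_stiefel N (n N) \<sigma>) (mat_gauss N (n N)) \<ge> c)"
proof (intro conjI)
  show "\<exists>c>0. \<forall>N\<ge>1. \<forall>\<sigma> :: real mat measure. is_stiefel_haar N (n N) \<sigma> \<longrightarrow>
      prohorov_dist (mat_metric N (n N)) (rescale_stiefel N (n N) \<sigma>) (mat_gauss N (n N)) \<ge> c"
    by (rule prohorov_dist_stiefel_gauss_ge) (use assms in blast)
  show "\<exists>c>0. \<forall>N\<ge>1. \<forall>\<sigma> :: complex mat measure. is_stiefel_haar N (n N) \<sigma> \<longrightarrow>
      prohorov_dist (mat_metric N (n N)) (rescale_stiefel N (n N) \<sigma>) (mat_gauss N (n N)) \<ge> c"
    by (rule prohorov_dist_stiefel_gauss_ge) (use assms in blast)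
  show "\<exists>c>0. \<forall>N\<ge>1. \<forall>\<sigma> :: quat mat measure. is_stiefel_haar N (n N) \<sigma> \<longrightarrow>
      prohorov_dist (mat_metric N (n N)) (rescale_stiefel N (n N) \<sigma>) (mat_gauss N (n N)) \<ge> c"
    by (rule prohorov_dist_stiefel_gauss_ge) (use assms in blast)
qed

end
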